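(* Let $G$ and $H$ be graph states on $n$ qupits with label matrices $M$ and $N$ over $\mathbb F_p$. Then $G$ and $H$ are equivalent under the local Clifford group if and only if $N$ can be obtained from $M$ by a finite sequence of the operations $\circ_b v$ ($v$ a vertex, $0\ne b\in\mathbb F_p$) and $*_a v$ ($v$ a vertex, $a\in\mathbb F_p$).
   Context: $p$ is an odd prime, $\omega=e^{2\pi i/p}$; on $\mathbb C^p$ with basis $\{|x\rangle\}_{x\in\mathbb F_p}$, $X(a)|x\rangle=|x+a\rangle$, $Z(b)|x\rangle=\omega^{bx}|x\rangle$; $X(\mathbf a)=\bigotimes_iX(\mathbf a_i)$, $Z(\mathbf b)=\bigotimes_iZ(\mathbf b_i)$; $\mathcal G_n=\{\omega^cX(\mathbf a)Z(\mathbf b)\}$. The Clifford group $\mathcal C$ is the normalizer of $\mathcal G_1$; the local Clifford group is $\mathcal C^{\otimes n}$; two states are equivalent under it if some $h\in\mathcal C^{\otimes n}$ maps one to a scalar multiple of the other. A graph state with label matrix $M$ ($M$ symmetric $n\times n$ over $\mathbb F_p$ with zero diagonal) is the common $1$-eigenvector of an abelian subgroup of $\mathcal G_n$ containing no nontrivial scalar, generated by operators $\omega^{c_i}X(\mathbf e_i)Z(M_i)$, $i=1,\dots,n$, where $\mathbf e_i$ is the $i$-th standard basis vector and $M_i$ the $i$-th row of $M$ (i.e. with generator matrix $(\mathrm{Id}_n\mid M)$); it is identified with the labeled graph on $\{1,\dots,n\}$ whose edge $\{i,j\}$ has label $M_{ij}$. Operations: for a vertex $v$ and $0\neq b\in\mathbb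 F_p$, $G\circ_b v$ has label matrix $I(v,b)\,M\,I(v,b)$, where $I(v,b)=\mathrm{diag}(1,\dots,1,b,1,\dots,1)$ with $b$ in position $v$. For a vertex $v$ and $a\in\mathbb F_p$, $G*_a v$ has label matrix $M'$ with $M'_{jk}=M_{jk}+aM_{vj}M_{vk}$ for $j\ne k$ and $M'_{jj}=0$. *)

theory Defs
  imports Complex_Main "Berlekamp_Zassenhaus.Finite_Field"
begin

text \<open>The field F_p is the type 'p mod_ring with CARD('p) = p prime.
  Single-qupit operators are p x p complex matrices indexed by F_p:
  U x y is the entry at row x, column y.  n-qupit states are vectors
  in C^(p^n), i.e. functions from ('n => F_p) to complex, where the
  finite type 'n indexes the n qupits.\<close>

type_synonym 'p op1 = "'p mod_ring \<Rightarrow> 'p mod_ring \<Rightarrow> complex"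

definition omega_pow :: "'p::prime_card mod_ring \<Rightarrow> complex" where
  "omega_pow k = cis (2 * pi * of_int (to_int_mod_ring k) / of_nat CARD('p))"

definition Xop :: "'p::prime_card mod_ring \<Rightarrow> 'p op1" where
  "Xop a = (\<lambda>x y. if x = y + a then 1 else 0)"

definition Zop :: "'p::prime_card mod_ring \<Rightarrow> 'p op1" where
  "Zop b = (\<lambda>x y. if x = y then omega_pow (b * x) else 0)"

definition mmult :: "'p::prime_card op1 \<Rightarrow> 'p op1 \<Rightarrow> 'p op1" where
  "mmult A B = (\<lambda>x y. \<Sum>z\<in>UNIV. A x z * B z y)"

definition adjoint1 :: "'p::prime_card op1 \<Rightarrow> 'p op1" where
  "adjoint1 A = (\<lambda>x y. cnj (A y x))"

definition id1 :: "'p::prime_card op1" where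
  "id1 = (\<lambda>x y. if x = y then 1 else 0)"

definition unitary1 :: "'p::prime_card op1 \<Rightarrow> bool" where
  "unitary1 U \<longleftrightarrow> mmult U (adjoint1 U) = id1 \<and> mmult (adjoint1 U) U = id1"

definition pauli1 :: "'p::prime_card op1 set" where
  "pauli1 = {(\<lambda>x y. omega_pow (c :: 'p mod_ring) * mmult (Xop a) (Zop b) x y) | c a b. True}"

definition clifford1 :: "'p::prime_card op1 \<Rightarrow> bool" where
  "clifford1 U \<longleftrightarrow> unitary1 U \<and>
     (\<lambda>P. mmult (mmult U P) (adjoint1 U)) ` (pauli1 :: 'p op1 set) = pauli1"

definition tensor_apply ::
  "('n::finite \<Rightarrow> 'p::prime_card op1) \<Rightarrow> (('n \<Rightarrow> 'p mod_ring) \<Rightarrow> complex)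
     \<Rightarrow> (('n \<Rightarrow> 'p mod_ring) \<Rightarrow> complex)" where
  "tensor_apply U \<psi> = (\<lambda>x. \<Sum>y\<in>UNIV. (\<Prod>i\<in>UNIV. U i (x i) (y i)) * \<psi> y)"

definition pauli_apply ::
  "'p::prime_card mod_ring \<Rightarrow> ('n::finite \<Rightarrow> 'p mod_ring) \<Rightarrow> ('n \<Rightarrow> 'p mod_ring)
     \<Rightarrow> (('n \<Rightarrow> 'p mod_ring) \<Rightarrow> complex) \<Rightarrow> (('n \<Rightarrow> 'p mod_ring) \<Rightarrow> complex)" where
  "pauli_apply c a b \<psi> =
     (\<lambda>x. omega_pow c * tensor_apply (\<lambda>i. mmult (Xop (a i)) (Zop (b i))) \<psi> x)"

definition unit_vec :: "'n \<Rightarrow> 'n \<Rightarrow> 'p::prime_card mod_ring" where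
  "unit_vec i = (\<lambda>j. if j = i then 1 else 0)"

definition label_matrix :: "('n \<Rightarrow> 'n \<Rightarrow> 'p::prime_card mod_ring) \<Rightarrow> bool" where
  "label_matrix M \<longleftrightarrow> (\<forall>i j. M i j = M j i) \<and> (\<forall>i. M i i = 0)"

definition graph_state ::
  "('n::finite \<Rightarrow> 'n \<Rightarrow> 'p::prime_card mod_ring) \<Rightarrow> (('n \<Rightarrow> 'p mod_ring) \<Rightarrow> complex) \<Rightarrow> bool" where
  "graph_state M \<psi> \<longleftrightarrow> \<psi> \<noteq> (\<lambda>_. 0) \<and>
     (\<exists>c :: 'n \<Rightarrow> 'p mod_ring. \<forall>i. pauli_apply (c i) (unit_vec i) (M i) \<psi> = \<psi>)"

definition LC_equiv ::
  "(('n::finite \<Rightarrow> 'p::prime_card mod_ring) \<Rightarrow> complex) \<Rightarrow> (('n \<Rightarrow> 'p mod_ring) \<Rightarrow> complex) \<Rightarrow> bool" where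
  "LC_equiv \<psi> \<phi> \<longleftrightarrow> (\<exists>U (s::complex). (\<forall>i. clifford1 (U i)) \<and>
      tensor_apply U \<psi> = (\<lambda>x. s * \<phi> x))"

definition circ_op :: "'n \<Rightarrow> 'p::prime_card mod_ring \<Rightarrow> ('n \<Rightarrow> 'n \<Rightarrow> 'p mod_ring) \<Rightarrow> ('n \<Rightarrow> 'n \<Rightarrow> 'p mod_ring)" where
  "circ_op v b M = (let d = (\<lambda>i. if i = v then b else 1) in (\<lambda>j k. d j * M j k * d k))"

definition star_op :: "'n \<Rightarrow> 'p::prime_card mod_ring \<Rightarrow> ('n \<Rightarrow> 'n \<Rightarrow> 'p mod_ring) \<Rightarrow> ('n \<Rightarrow> 'n \<Rightarrow> 'p mod_ring)" where
  "star_op v a M = (\<lambda>j k. if j = k then 0 else M j k + a * M v j * M v k)"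

definition graph_step :: "('n \<Rightarrow> 'n \<Rightarrow> 'p::prime_card mod_ring) \<Rightarrow> ('n \<Rightarrow> 'n \<Rightarrow> 'p mod_ring) \<Rightarrow> bool" where
  "graph_step M N \<longleftrightarrow> (\<exists>v b. b \<noteq> 0 \<and> N = circ_op v b M) \<or> (\<exists>v a. N = star_op v a M)"

end

theory Submission
  imports Defs "HOL-Library.FuncSet"
begin

text \<open>Since \<open>p\<close> is odd, the amplitudes of a graph state with label matrix \<open>M\<close> are, up to a scalar,
  \<open>\<omega>\<close> to the power \<open>x\<^sup>T M x / 2 + l \<cdot> x\<close>. Hence \<open>\<circ>\<^sub>b v\<close> is realised by a dilation of the coordinate \<open>x\<^sub>v\<close>, and
  \<open>*\<^sub>a v\<close> by a convolution with a quadratic phase in \<open>x\<^sub>v\<close> together with diagonal quadratic phases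
  at the other vertices.

  Conversely, each Clifford operator induces a matrix \<open>(a b; c d)\<close> in \<open>SL\<^sub>2(F\<^sub>p)\<close> on the labels of \<open>X(m) Z(n)\<close>, so an
  equivalence of graph states yields \<open>N (A x + B M x) = C x + D M x\<close> for all \<open>x\<close>, with diagonal matrices
  \<open>A, B, C, D\<close>. Operations \<open>*\<close> change \<open>M\<close> until \<open>B = 0\<close>, and then \<open>N = D M D\<close>.\<close>

section \<open>Powers of the root of unity\<close>

text \<open>Changing the representative by a multiple of p turns the angle by a multiple of 2 pi.
  With arbitrary integer exponents, additivity reduces to that of angles.\<close>

lemma omega_pow_of_int:
  "omega_pow (of_int n :: 'p::prime_card mod_ring) = cis (2 * pi * of_int n / of_nat CARD('p))"
proof -
  let ?p = "int CARD('p)"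
  have "to_int_mod_ring (of_int n :: 'p mod_ring) = n mod ?p"
    unfolding of_int_of_int_mod_ring by transfer simp
  moreover have "2 * pi * of_int n / of_nat CARD('p)
      = 2 * pi * of_int (n mod ?p) / of_nat CARD('p) + 2 * pi * of_int (n div ?p)"
  proof -
    have "(of_int n :: real) = of_int (?p * (n div ?p) + n mod ?p)" by simp
    also have "\<dots> = of_nat CARD('p) * of_int (n div ?p) + of_int (n mod ?p)"
      by (simp only: of_int_add of_int_mult of_int_of_nat_eq)
    finally show ?thesis by (simp add: field_simps)
  qed
  ultimately show ?thesis
    by (simp add: omega_pow_def flip: cis_mult)
qed

lemma omega_pow_add: "omega_pow (a + b) = omega_pow a * omega_pow (b :: 'p::prime_card mod_ring)"
proof -
  obtain i j :: int where ij: "a = of_int i" "b = of_int j"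
    by (metis of_int_mod_ring_to_int_mod_ring of_int_of_int_mod_ring)
  show ?thesis
    unfolding ij of_int_add[symmetric] omega_pow_of_int
    by (simp add: cis_mult add_divide_distrib distrib_left)
qed

lemma omega_pow_0 [simp]: "omega_pow 0 = 1"
  by (simp add: omega_pow_def)

lemma omega_pow_neq_0 [simp]: "omega_pow a \<noteq> 0"
  by (simp add: omega_pow_def)

lemma omega_pow_mult_uminus [simp]: "omega_pow a * omega_pow (- a) = 1"
  by (simp flip: omega_pow_add)

lemma cnj_omega_pow: "cnj (omega_pow a) = omega_pow (- a)"
proof -
  have "cnj (omega_pow a) * omega_pow a = 1"
    by (simp add: omega_pow_def cis_cnj cis_mult)
  then have "cnj (omega_pow a) * (omega_pow a * omega_pow (- a)) = omega_pow (- a)"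
    by (simp only: mult.assoc[symmetric]) simp
  then show ?thesis by simp
qed

lemma omega_pow_sum: "omega_pow (\<Sum>i\<in>A. f i) = (\<Prod>i\<in>A. omega_pow (f i))"
  by (induction A rule: infinite_finite_induct) (simp_all add: omega_pow_add)

lemma omega_pow_eq_1_iff: "omega_pow a = 1 \<longleftrightarrow> (a :: 'p::prime_card mod_ring) = 0"
proof
  assume *: "omega_pow a = 1"
  define r where "r = to_int_mod_ring a"
  have r: "0 \<le> r" "r < int CARD('p)"
    using range_to_int_mod_ring[where 'a='p] by (auto simp: r_def)
  have "cos (2 * pi * of_int r / of_nat CARD('p)) = 1"
    using * by (simp add: omega_pow_def r_def complex_eq_iff)
  then obtain n :: int where "2 * pi * of_int r / of_nat CARD('p) = of_int n * 2 * pi"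
    unfolding cos_one_2pi_int by blast
  then have "(of_int r :: real) = of_int (n * int CARD('p))"
    by (simp add: field_simps)
  then have "r = n * int CARD('p)" by (simp only: of_int_eq_iff)
  with r have "r = 0"
    by (metis mod_mult_self2_is_0 mod_pos_pos_trivial)
  then show "a = 0" by (simp add: r_def)
qed simp

lemma omega_pow_eq_iff [simp]: "omega_pow a = omega_pow b \<longleftrightarrow> a = b"
proof
  assume "omega_pow a = omega_pow b"
  then have "omega_pow (a - b) = 1"
    using omega_pow_add[of a "- b"] by simp
  then show "a = b" by (simp add: omega_pow_eq_1_iff)
qed simp

text \<open>Replacing z by z + 1 multiplies the sum by \<open>omega_pow k\<close>, which differs
  from 1 unless k = 0.\<close>

lemma sum_omega_pow:
  "(\<Sum>z\<in>UNIV. omega_pow (k * z)) = (if k = 0 then of_nat CARD('p) else 0)"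
  for k :: "'p::prime_card mod_ring"
proof (cases "k = 0")
  case False
  let ?S = "\<Sum>z\<in>UNIV. omega_pow (k * z)"
  have "?S = (\<Sum>z\<in>UNIV. omega_pow (k * (z + 1)))"
    by (rule sum.reindex_bij_witness[of _ "\<lambda>z. z + 1" "\<lambda>z. z - 1"]) auto
  also have "\<dots> = ?S * omega_pow k"
    by (simp add: distrib_left omega_pow_add sum_distrib_right)
  finally have "?S * (omega_pow k - 1) = 0" by (simp add: algebra_simps)
  then show ?thesis using False by (simp add: omega_pow_eq_1_iff)
qed simp

section \<open>Clifford operators\<close>

lemma mmult_assoc: "mmult (mmult A B) C = mmult A (mmult B C)"
proof (intro ext)
  fix x y
  have "mmult (mmult A B) C x y = (\<Sum>z\<in>UNIV. \<Sum>w\<in>UNIV. A x w * B w z * C z y)"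
    by (simp add: mmult_def sum_distrib_right)
  also have "\<dots> = (\<Sum>w\<in>UNIV. \<Sum>z\<in>UNIV. A x w * B w z * C z y)"
    by (rule sum.swap)
  finally show "mmult (mmult A B) C x y = mmult A (mmult B C) x y"
    by (simp add: mmult_def sum_distrib_left mult.assoc)
qed

lemma mmult_id1 [simp]: "mmult id1 A = A" "mmult A id1 = A"
  by (simp_all add: mmult_def id1_def if_distrib[of "\<lambda>t. t * _"] if_distrib[of "\<lambda>t. _ * t"] cong: if_cong)

lemma adjoint1_mmult: "adjoint1 (mmult A B) = mmult (adjoint1 B) (adjoint1 A)"
  by (simp add: adjoint1_def mmult_def fun_eq_iff mult.commute)

lemma unitary1_mmult:
  assumes "unitary1 A" "unitary1 B"
  shows "unitary1 (mmult A B)"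
proof -
  have "mmult (mmult A B) (adjoint1 (mmult A B)) = mmult A (mmult (mmult B (adjoint1 B)) (adjoint1 A))"
    by (simp add: adjoint1_mmult mmult_assoc)
  moreover have "mmult (adjoint1 (mmult A B)) (mmult A B)
      = mmult (adjoint1 B) (mmult (mmult (adjoint1 A) A) B)"
    by (simp add: adjoint1_mmult mmult_assoc)
  ultimately show ?thesis using assms by (simp add: unitary1_def)
qed

lemma clifford1_mmult:
  assumes "clifford1 A" "clifford1 B"
  shows "clifford1 (mmult A B)"
proof -
  let ?c = "\<lambda>U P. mmult (mmult U P) (adjoint1 U)"
  have "?c (mmult A B) ` pauli1 = ?c A ` ?c B ` pauli1"
    by (simp add: image_image adjoint1_mmult mmult_assoc)
  then show ?thesis
    using assms by (simp add: clifford1_def unitary1_mmult)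
qed

section \<open>Products with Pauli operators and conjugation\<close>

lemma mmult_Xop_Zop: "mmult (Xop a) (Zop b) x y = (if y = x - a then omega_pow (b * y) else 0)"
proof -
  have "mmult (Xop a) (Zop b) x y = (\<Sum>z\<in>UNIV. if z = y then (if y = x - a then omega_pow (b * y) else 0) else 0)"
    unfolding mmult_def Xop_def Zop_def by (rule sum.cong) (auto simp: algebra_simps)
  then show ?thesis by simp
qed

lemma mmult_pauli:
  "mmult U (mmult (Xop a) (Zop b)) x y = U x (y + a) * omega_pow (b * y)"
  "mmult (mmult (Xop a) (Zop b)) U x y = omega_pow (b * (x - a)) * U (x - a) y"
proof -
  have "mmult U (mmult (Xop a) (Zop b)) x y
      = (\<Sum>z\<in>UNIV. if z = y + a then U x (y + a) * omega_pow (b * y) else 0)"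
    unfolding mmult_def[of U] mmult_Xop_Zop by (rule sum.cong) (auto simp: algebra_simps)
  then show "mmult U (mmult (Xop a) (Zop b)) x y = U x (y + a) * omega_pow (b * y)" by simp
  have "mmult (mmult (Xop a) (Zop b)) U x y
      = (\<Sum>z\<in>UNIV. if z = x - a then omega_pow (b * (x - a)) * U (x - a) y else 0)"
    unfolding mmult_def[of _ U] mmult_Xop_Zop by (rule sum.cong) auto
  then show "mmult (mmult (Xop a) (Zop b)) U x y = omega_pow (b * (x - a)) * U (x - a) y" by simp
qed

lemma mmult_scale:
  "mmult (\<lambda>x y. k * A x y) B = (\<lambda>x y. k * mmult A B x y)"
  "mmult A (\<lambda>x y. k * B x y) = (\<lambda>x y. k * mmult A B x y)"
  by (simp_all add: mmult_def sum_distrib_left mult_ac)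

text \<open>Entrywise form of \<open>U X(a) Z(b) = \<omega>\<^sup>c X(a') Z(b') U\<close> for some \<open>c\<close>.\<close>

definition carries :: "'p::prime_card op1 \<Rightarrow> 'p mod_ring \<Rightarrow> 'p mod_ring
    \<Rightarrow> 'p mod_ring \<Rightarrow> 'p mod_ring \<Rightarrow> bool" where
  "carries U a b a' b' \<longleftrightarrow>
     (\<exists>c. \<forall>x y. U x (y + a) * omega_pow (b * y) = omega_pow (c + b' * (x - a')) * U (x - a') y)"

lemma carries_iff:
  fixes U :: "'p::prime_card op1"
  shows "carries U a b a' b' \<longleftrightarrow> (\<exists>c. mmult U (mmult (Xop a) (Zop b))
     = (\<lambda>x y. omega_pow (c :: 'p mod_ring) * mmult (mmult (Xop a') (Zop b')) U x y))"
  by (simp add: carries_def fun_eq_iff mmult_pauli omega_pow_add mult.assoc)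

text \<open>Conjugation by a unitary is injective and \<open>pauli1\<close> is finite, so mapping
  \<open>pauli1\<close> into itself already means mapping it onto itself.\<close>

lemma clifford1I:
  fixes U :: "'p::prime_card op1"
  assumes U: "unitary1 U" and carries: "\<And>a b. \<exists>a' b'. carries U a b a' b'"
  shows "clifford1 U"
proof -
  let ?f = "\<lambda>P. mmult (mmult U P) (adjoint1 U)"
  have "?f P \<in> pauli1" if "P \<in> pauli1" for P
  proof -
    from that obtain c a b where P: "P = (\<lambda>x y. omega_pow (c::'p mod_ring) * mmult (Xop a) (Zop b) x y)"
      unfolding pauli1_def by blast
    obtain a' b' and d :: "'p mod_ring" where "mmult U (mmult (Xop a) (Zop b))
        = (\<lambda>x y. omega_pow d * mmult (mmult (Xop a') (Zop b')) U x y)"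
      using carries[of a b] unfolding carries_iff by blast
    then have "?f P = (\<lambda>x y. omega_pow (c + d) * mmult (Xop a') (Zop b') x y)"
      using U unfolding P by (simp add: mmult_scale mmult_assoc unitary1_def omega_pow_add mult.assoc)
    then show ?thesis unfolding pauli1_def by blast
  qed
  then have "?f ` pauli1 \<subseteq> pauli1" by blast
  moreover have "inj_on ?f pauli1"
  proof (rule inj_on_inverseI)
    fix P :: "'p op1"
    have "mmult (mmult (adjoint1 U) (?f P)) U = mmult (mmult (mmult (adjoint1 U) U) P) (mmult (adjoint1 U) U)"
      by (simp add: mmult_assoc)
    then show "mmult (mmult (adjoint1 U) (?f P)) U = P"
      using U by (simp add: unitary1_def)
  qed
  moreover have "finite (pauli1 :: 'p op1 set)"
  proof -
    have "(pauli1 :: 'p op1 set)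
        = (\<Union>c::'p mod_ring. \<Union>a. \<Union>b. {\<lambda>x y. omega_pow c * mmult (Xop a) (Zop b) x y})"
      unfolding pauli1_def by blast
    also have "finite \<dots>" by (intro finite_UN_I finite_class.finite_UNIV finite.intros)
    finally show ?thesis .
  qed
  ultimately have "?f ` pauli1 = pauli1"
    by (rule endo_inj_surj[rotated])
  then show ?thesis using U by (simp add: clifford1_def)
qed

lemma clifford1_carries:
  fixes U :: "'p::prime_card op1"
  assumes "clifford1 U"
  shows "\<exists>a' b'. carries U a b a' b'"
proof -
  let ?P = "mmult (Xop a) (Zop b) :: 'p op1"
  have "(\<lambda>x y. omega_pow (0::'p mod_ring) * ?P x y) \<in> pauli1"
    unfolding pauli1_def by blast
  then have "mmult (mmult U ?P) (adjoint1 U) \<in> pauli1"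
    using assms by (auto simp: clifford1_def)
  then obtain c a' b' where "mmult (mmult U ?P) (adjoint1 U)
      = (\<lambda>x y. omega_pow (c::'p mod_ring) * mmult (Xop a') (Zop b') x y)"
    unfolding pauli1_def by blast
  then have "mmult (mmult (mmult U ?P) (adjoint1 U)) U
      = (\<lambda>x y. omega_pow c * mmult (mmult (Xop a') (Zop b')) U x y)"
    by (simp add: mmult_scale)
  moreover have "mmult (mmult (mmult U ?P) (adjoint1 U)) U = mmult U ?P"
    using assms by (simp add: mmult_assoc clifford1_def unitary1_def)
  ultimately show ?thesis unfolding carries_iff by metis
qed

text \<open>Two Pauli relations are composed with the phase kept explicit: \<open>b1' * a2'\<close>
  and \<open>b1 * a2\<close> come from moving Z past X after and before \<open>U\<close>. Their
  asymmetry in the two factors later yields the determinant.\<close>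

lemma carries_add_phase:
  assumes 1: "\<And>x y. U x (y + a1) * omega_pow (b1 * y) = omega_pow (c1 + b1' * (x - a1')) * U (x - a1') y"
    and 2: "\<And>x y. U x (y + a2) * omega_pow (b2 * y) = omega_pow (c2 + b2' * (x - a2')) * U (x - a2') y"
  shows "U x (y + (a1 + a2)) * omega_pow ((b1 + b2) * y)
    = omega_pow ((c1 + c2 + b1' * a2' - b1 * a2) + (b1' + b2') * (x - (a1' + a2'))) * U (x - (a1' + a2')) y"
proof -
  have "U x (y + (a1 + a2)) * omega_pow ((b1 + b2) * y)
      = (U x ((y + a2) + a1) * omega_pow (b1 * (y + a2))) * omega_pow (b2 * y - b1 * a2)"
    by (simp add: mult.assoc flip: omega_pow_add) (simp add: algebra_simps)
  also have "\<dots> = omega_pow (c1 + b1' * (x - a1') - b1 * a2)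
      * (U (x - a1') (y + a2) * omega_pow (b2 * y))"
    by (simp add: 1 omega_pow_add diff_conv_add_uminus del: add_uminus_conv_diff)
  also have "\<dots> = omega_pow (c1 + b1' * (x - a1') - b1 * a2 + (c2 + b2' * (x - a1' - a2')))
      * U (x - a1' - a2') y"
    by (simp only: 2 omega_pow_add mult.assoc)
  also have "c1 + b1' * (x - a1') - b1 * a2 + (c2 + b2' * (x - a1' - a2'))
      = (c1 + c2 + b1' * a2' - b1 * a2) + (b1' + b2') * (x - (a1' + a2'))"
    by (simp add: algebra_simps)
  finally show ?thesis by (simp add: diff_diff_eq)
qed

lemma carries_add:
  assumes "carries U a1 b1 a1' b1'" "carries U a2 b2 a2' b2'"
  shows "carries U (a1 + a2) (b1 + b2) (a1' + a2') (b1' + b2')"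
proof -
  obtain c1 where 1: "\<And>x y. U x (y + a1) * omega_pow (b1 * y) = omega_pow (c1 + b1' * (x - a1')) * U (x - a1') y"
    using assms(1) unfolding carries_def by blast
  obtain c2 where 2: "\<And>x y. U x (y + a2) * omega_pow (b2 * y) = omega_pow (c2 + b2' * (x - a2')) * U (x - a2') y"
    using assms(2) unfolding carries_def by blast
  show ?thesis
    unfolding carries_def using carries_add_phase[of U, OF 1 2] by blast
qed

text \<open>Every element of F_p is a natural multiple of 1, so repeated addition reaches every
  scalar.\<close>

lemma carries_scale:
  fixes U :: "'p::prime_card op1"
  assumes "carries U a b a' b'"
  shows "carries U (k * a) (k * b) (k * a') (k * b')"
proof -
  have "carries U (of_nat i * a) (of_nat i * b) (of_nat i * a') (of_nat i * b')" for i
  proof (induction i)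
    case 0
    show ?case by (auto simp: carries_def intro!: exI[of _ 0])
  next
    case (Suc i)
    then show ?case using carries_add[OF assms Suc] by (simp add: algebra_simps)
  qed
  then show ?thesis by (metis surj_of_nat_mod_ring)
qed

text \<open>The columns of the matrix are the labels of the images of X(1) and Z(1). Its determinant
  is 1 because conjugation preserves the commutation phase of X(1) and Z(1).\<close>

lemma clifford1_symplectic:
  fixes U :: "'p::prime_card op1"
  assumes "clifford1 U"
  shows "\<exists>a b c d. a * d - b * c = 1 \<and> (\<forall>m n. carries U m n (a * m + b * n) (c * m + d * n))"
proof -
  obtain a c where X: "carries U 1 0 a c" using clifford1_carries[OF assms] by blast
  obtain b d where Z: "carries U 0 1 b d" using clifford1_carries[OF assms] by blast
  obtain s where s: "\<And>x y. U x (y + 1) * omega_pow (0 * y) = omega_pow (s + c * (x - a)) * U (x - a) y"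
    using X unfolding carries_def by blast
  obtain t where t: "\<And>x y. U x (y + 0) * omega_pow (1 * y) = omega_pow (t + d * (x - b)) * U (x - b) y"
    using Z unfolding carries_def by blast
  have "\<exists>x y. U x y \<noteq> 0"
  proof (rule ccontr)
    assume "\<not> ?thesis"
    then have "mmult U (adjoint1 U) 0 0 = 0" by (simp add: mmult_def)
    then show False using assms by (simp add: clifford1_def unitary1_def id1_def)
  qed
  then obtain x y where "U x y \<noteq> 0" by blast
  then have xy: "U ((x + (a + b)) - (a + b)) y \<noteq> 0" by simp
  \<comment> \<open>Both orders of composing X(1) and Z(1) give the same left-hand side, so at a
    nonzero entry of \<open>U\<close> the phases \<open>c * b\<close> and \<open>d * a - 1\<close>
    agree.\<close>
  have "omega_pow ((s + t + c * b - 0 * 0) + (c + d) * ((x + (a + b)) - (a + b))) * U ((x + (a + b)) - (a + b)) y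
      = omega_pow ((t + s + d * a - 1 * 1) + (d + c) * ((x + (b + a)) - (b + a))) * U ((x + (b + a)) - (b + a)) y"
    using carries_add_phase[of U, OF s t, of "x + (a + b)" y] carries_add_phase[of U, OF t s, of "x + (b + a)" y]
    by (simp add: add.commute)
  then have "a * d - b * c = 1"
    using xy by (simp add: algebra_simps)
  moreover have "carries U m n (a * m + b * n) (c * m + d * n)" for m n
    using carries_add[OF carries_scale[OF X, of m] carries_scale[OF Z, of n]]
    by (simp add: mult.commute)
  ultimately show ?thesis by blast
qed

section \<open>Local symplectic maps between graphs\<close>

text \<open>The maps \<open>(x\<^sub>k, z\<^sub>k) \<mapsto> (a\<^sub>k x\<^sub>k + b\<^sub>k z\<^sub>k, c\<^sub>k x\<^sub>k + d\<^sub>k z\<^sub>k)\<close>, one in \<open>SL\<^sub>2(F\<^sub>p)\<close> for each vertex,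
  send the row space of \<open>(Id | M)\<close> into that of \<open>(Id | N)\<close>.\<close>

definition local_symplectic :: "('n::finite \<Rightarrow> 'n \<Rightarrow> 'p::prime_card mod_ring) \<Rightarrow> ('n \<Rightarrow> 'n \<Rightarrow> 'p mod_ring)
    \<Rightarrow> ('n \<Rightarrow> 'p mod_ring) \<Rightarrow> ('n \<Rightarrow> 'p mod_ring) \<Rightarrow> ('n \<Rightarrow> 'p mod_ring) \<Rightarrow> ('n \<Rightarrow> 'p mod_ring) \<Rightarrow> bool" where
  "local_symplectic M N a b c d \<longleftrightarrow> (\<forall>k. a k * d k - b k * c k = 1) \<and>
     (\<forall>x j. (\<Sum>k\<in>UNIV. N j k * (a k * x k + b k * (\<Sum>l\<in>UNIV. M k l * x l)))
        = c j * x j + d j * (\<Sum>l\<in>UNIV. M j l * x l))"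

lemma label_matrix_star_op: "label_matrix M \<Longrightarrow> label_matrix (star_op v s M)"
  by (auto simp: label_matrix_def star_op_def mult_ac)

lemma label_matrix_circ_op: "label_matrix M \<Longrightarrow> label_matrix (circ_op v s M)"
  by (auto simp: label_matrix_def circ_op_def Let_def mult_ac)

lemma label_matrix_graph_step: "graph_step M N \<Longrightarrow> label_matrix M \<Longrightarrow> label_matrix N"
  by (auto simp: graph_step_def intro: label_matrix_star_op label_matrix_circ_op)

lemma sum_mult_fun_upd:
  fixes M :: "'n::finite \<Rightarrow> 'a::comm_ring_1"
  shows "(\<Sum>l\<in>UNIV. M l * (x(v := x v + t)) l) = (\<Sum>l\<in>UNIV. M l * x l) + M v * t"
proof -
  have "(\<Sum>l\<in>UNIV. M l * (x(v := x v + t)) l) = (\<Sum>l\<in>UNIV. M l * x l + (if l = v then M v * t else 0))"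
    by (rule sum.cong) (auto simp: algebra_simps)
  then show ?thesis by (simp add: sum.distrib)
qed

text \<open>Off the diagonal, \<open>star_op\<close> is a rank-one update by row \<open>v\<close>;
  the last term takes back what this update would put on the diagonal.\<close>

lemma star_op_mult_vec:
  fixes M :: "'n::finite \<Rightarrow> 'n \<Rightarrow> 'p::prime_card mod_ring"
  assumes "label_matrix M"
  shows "(\<Sum>l\<in>UNIV. star_op v s M j l * x l)
    = (\<Sum>l\<in>UNIV. M j l * x l) + s * M v j * (\<Sum>l\<in>UNIV. M v l * x l) - s * (M v j)\<^sup>2 * x j"
proof -
  have "(\<Sum>l\<in>UNIV. star_op v s M j l * x l)
      = (\<Sum>l\<in>UNIV. M j l * x l + s * M v j * (M v l * x l) - (if l = j then s * (M v j)\<^sup>2 * x j else 0))"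
    using assms by (intro sum.cong) (auto simp: star_op_def label_matrix_def algebra_simps power2_eq_square)
  then show ?thesis by (simp add: sum.distrib sum_subtractf sum_distrib_left)
qed

text \<open>The shears x_v -> x_v + s z_v at \<open>v\<close> and z_k -> z_k + s (M v k)^2 x_k at
  every k carry the row space of (Id | \<open>star_op v s M\<close>) into that of (Id | M). The new
  coefficients come from composing them with the given map.\<close>

lemma local_symplectic_star_op:
  fixes M :: "'n::finite \<Rightarrow> 'n \<Rightarrow> 'p::prime_card mod_ring"
  assumes M: "label_matrix M" and MN: "local_symplectic M N a b c d"
  shows "local_symplectic (star_op v s M) N
    (\<lambda>k. a k + b k * (s * (M v k)\<^sup>2)) (b(v := b v + s * a v))
    (\<lambda>k. c k + d k * (s * (M v k)\<^sup>2)) (d(v := d v + s * c v))"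
proof -
  let ?M' = "star_op v s M"
  let ?a = "\<lambda>k. a k + b k * (s * (M v k)\<^sup>2)" and ?b = "b(v := b v + s * a v)"
  let ?c = "\<lambda>k. c k + d k * (s * (M v k)\<^sup>2)" and ?d = "d(v := d v + s * c v)"
  have Mvv: "M v v = 0" and sym: "M i j = M j i" for i j using M by (auto simp: label_matrix_def)
  have "?a k * ?d k - ?b k * ?c k = a k * d k - b k * c k" for k
    by (auto simp: algebra_simps Mvv)
  then have det: "?a k * ?d k - ?b k * ?c k = 1" for k
    using MN by (simp add: local_symplectic_def)
  have "(\<Sum>k\<in>UNIV. N j k * (?a k * x k + ?b k * (\<Sum>l\<in>UNIV. ?M' k l * x l)))
      = ?c j * x j + ?d j * (\<Sum>l\<in>UNIV. ?M' j l * x l)" for x j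
  proof -
    define m where "m = (\<Sum>l\<in>UNIV. M v l * x l)"
    \<comment> \<open>The shears send the pair of \<open>x\<close> and \<open>w\<close> to the pair
      of \<open>y\<close> and M y.\<close>
    define y where "y = x(v := x v + s * m)"
    define w where "w k = (\<Sum>l\<in>UNIV. ?M' k l * x l)" for k
    have My: "(\<Sum>l\<in>UNIV. M k l * y l) = w k + s * (M v k)\<^sup>2 * x k" for k
      unfolding y_def w_def sum_mult_fun_upd star_op_mult_vec[OF M] m_def sym[of k v]
      by (simp add: algebra_simps)
    have wv: "w v = m"
      unfolding w_def star_op_mult_vec[OF M] m_def by (simp add: Mvv)
    \<comment> \<open>Used with \<open>a\<close>, \<open>b\<close> for \<open>f\<close>,
      \<open>g\<close> and again with \<open>c\<close>, \<open>d\<close>, so it rewrites both sides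
      of the condition.\<close>
    have split: "f k * y k + g k * (\<Sum>l\<in>UNIV. M k l * y l)
        = (f k + g k * (s * (M v k)\<^sup>2)) * x k + (g(v := g v + s * f v)) k * w k"
      for f g :: "'n \<Rightarrow> 'p mod_ring" and k
      unfolding My by (cases "k = v") (simp_all add: wv Mvv y_def algebra_simps)
    show ?thesis
      using MN unfolding local_symplectic_def w_def[symmetric] split[symmetric] by blast
  qed
  with det show ?thesis unfolding local_symplectic_def by blast
qed

text \<open>Taking the i-th basis vector for x gives the entries of N (A + B M) = C + D M with
  diagonal A, B, C, D.\<close>

lemma local_symplectic_unit_vec:
  fixes M :: "'n::finite \<Rightarrow> 'n \<Rightarrow> 'p::prime_card mod_ring"
  assumes "local_symplectic M N a b c d"
  shows "N j i * a i + (\<Sum>k\<in>UNIV. N j k * (b k * M k i)) = (if i = j then c j else 0) + d j * M j i"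
proof -
  have e: "(\<Sum>l\<in>UNIV. M k l * unit_vec i l) = M k i" for k
    by (simp add: unit_vec_def if_distrib[of "\<lambda>t. _ * t"] cong: if_cong)
  have "(\<Sum>k\<in>UNIV. N j k * (a k * unit_vec i k + b k * (\<Sum>l\<in>UNIV. M k l * unit_vec i l)))
      = c j * unit_vec i j + d j * (\<Sum>l\<in>UNIV. M j l * unit_vec i l)"
    using assms unfolding local_symplectic_def by blast
  then have "(\<Sum>k\<in>UNIV. N j k * (a k * unit_vec i k + b k * M k i)) = c j * unit_vec i j + d j * M j i"
    unfolding e .
  moreover have "(\<Sum>k\<in>UNIV. N j k * (a k * unit_vec i k)) = N j i * a i"
    by (simp add: unit_vec_def if_distrib[of "\<lambda>t. _ * t"] cong: if_cong)
  ultimately show ?thesis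
    by (simp add: distrib_left sum.distrib) (auto simp: unit_vec_def)
qed

text \<open>The diagonal congruence is built up one vertex at a time, with \<open>A\<close> the set
  of vertices already rescaled.\<close>

lemma graph_steps_rescale:
  fixes M :: "'n::finite \<Rightarrow> 'n \<Rightarrow> 'p::prime_card mod_ring"
  assumes "\<And>i. d i \<noteq> 0"
  shows "graph_step\<^sup>*\<^sup>* M (\<lambda>j k. d j * M j k * d k)"
proof -
  have "graph_step\<^sup>*\<^sup>* M (\<lambda>j k. (if j \<in> A then d j else 1) * M j k * (if k \<in> A then d k else 1))"
    if "finite A" for A
    using that
  proof (induction A rule: finite_induct)
    case empty
    show ?case by simp
  next
    case (insert v A)
    let ?M = "\<lambda>A j k. (if j \<in> A then d j else 1) * M j k * (if k \<in> A then d k else 1)"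
    have "?M (insert v A) = circ_op v (d v) (?M A)"
    proof (intro ext)
      fix j k
      show "?M (insert v A) j k = circ_op v (d v) (?M A) j k"
        using insert.hyps by (cases "j = v"; cases "k = v") (simp_all add: circ_op_def mult_ac)
    qed
    then have "graph_step (?M A) (?M (insert v A))"
      using assms unfolding graph_step_def by blast
    with insert.IH show ?case by (rule rtranclp.rtrancl_into_rtrancl[of graph_step])
  qed
  from this[of UNIV] show ?thesis by simp
qed

text \<open>Induction on the number of vertices \<open>v\<close> with \<open>b v \<noteq> 0\<close>. If \<open>a v \<noteq> 0\<close> for one of them, an operation
  \<open>*\<close> at \<open>v\<close> makes \<open>b v\<close> vanish. Otherwise some two of them are adjacent, by injectivity of the
  symplectic map, and an operation \<open>*\<close> at one of them makes \<open>a\<close> nonzero at the other.\<close>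

lemma local_symplectic_imp_graph_steps:
  fixes M :: "'n::finite \<Rightarrow> 'n \<Rightarrow> 'p::prime_card mod_ring"
  assumes "label_matrix M" "label_matrix N" "local_symplectic M N a b c d"
  shows "graph_step\<^sup>*\<^sup>* M N"
  using assms
proof (induction "card {v. b v \<noteq> 0}" arbitrary: M a b c d rule: less_induct)
  case less
  note M = less.prems(1) and N = less.prems(2) and MN = less.prems(3)
  have det: "a k * d k - b k * c k = 1" for k
    using MN by (simp add: local_symplectic_def)
  \<comment> \<open>The matrix and \<open>a'\<close> vary while \<open>b\<close> stays fixed, so
    that this applies both to \<open>M\<close> and after a preliminary star operation that preserves
    \<open>b\<close>.\<close>
  have reduce: "graph_step\<^sup>*\<^sup>* M' N"
    if M': "label_matrix M'" "local_symplectic M' N a' b c' d'" and v: "a' v \<noteq> 0" "b v \<noteq> 0"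
    for M' a' c' d' v
  proof -
    \<comment> \<open>This value solves b v + s * a' v = 0.\<close>
    let ?s = "- b v / a' v"
    have "{k. (b(v := b v + ?s * a' v)) k \<noteq> 0} = {k. b k \<noteq> 0} - {v}"
      using v by auto
    also have "card \<dots> < card {k. b k \<noteq> 0}"
      using v by (intro psubset_card_mono) auto
    finally have "graph_step\<^sup>*\<^sup>* (star_op v ?s M') N"
      using less.hyps label_matrix_star_op[OF M'(1)] N local_symplectic_star_op[OF M'] by blast
    moreover have "graph_step M' (star_op v ?s M')"
      unfolding graph_step_def by blast
    ultimately show ?thesis by (meson converse_rtranclp_into_rtranclp)
  qed
  consider "\<And>v. b v = 0" | v where "b v \<noteq> 0" "a v \<noteq> 0"
    | v where "b v \<noteq> 0" "\<And>k. b k \<noteq> 0 \<Longrightarrow> a k = 0" by blast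
  then show ?case
  proof cases
    case 1
    have ad: "a k * d k = 1" for k using det[of k] 1 by simp
    have "N j k = d j * M j k * d k" for j k
    proof (cases "j = k")
      case True
      then show ?thesis using M N by (simp add: label_matrix_def)
    next
      case False
      then have "N j k * a k = d j * M j k"
        using local_symplectic_unit_vec[OF MN, of j k] 1 by simp
      then have "N j k * (a k * d k) = d j * M j k * d k"
        by (simp only: mult.assoc[symmetric])
      then show ?thesis by (simp add: ad)
    qed
    then have "N = (\<lambda>j k. d j * M j k * d k)" by blast
    moreover have "d k \<noteq> 0" for k using ad[of k] by auto
    ultimately show ?thesis using graph_steps_rescale by blast
  next
    case 2
    then show ?thesis using reduce[OF M MN] by blast
  next
    case 3
    \<comment> \<open>Otherwise the diagonal entry at \<open>v\<close> of the matrix identity forces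
      \<open>c v = 0\<close>, and with \<open>a v = 0\<close> the determinant at \<open>v\<close>
      vanishes.\<close>
    have "\<exists>k. b k \<noteq> 0 \<and> M v k \<noteq> 0"
    proof (rule ccontr)
      assume "\<not> ?thesis"
      then have "b k * M k v = 0" for k
        using M by (metis label_matrix_def mult_eq_0_iff)
      moreover have "a v = 0" using 3 by blast
      ultimately have "c v + d v * M v v = 0"
        using local_symplectic_unit_vec[OF MN, of v v] by (simp del: mult_eq_0_iff)
      then have "c v = 0" using M by (simp add: label_matrix_def)
      with \<open>a v = 0\<close> show False using det[of v] by simp
    qed
    then obtain k where k: "b k \<noteq> 0" "M v k \<noteq> 0" by blast
    have "b(v := b v + 1 * a v) = b" using 3 by auto
    then have "local_symplectic (star_op v 1 M) N (\<lambda>k. a k + b k * (1 * (M v k)\<^sup>2)) b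
        (\<lambda>k. c k + d k * (1 * (M v k)\<^sup>2)) (d(v := d v + 1 * c v))"
      using local_symplectic_star_op[OF M MN, of v 1] by simp
    \<comment> \<open>Here \<open>a k = 0\<close>, because \<open>k\<close> too lies in the support
      of \<open>b\<close>.\<close>
    moreover have "a k + b k * (1 * (M v k)\<^sup>2) \<noteq> 0" using k 3 by simp
    ultimately have "graph_step\<^sup>*\<^sup>* (star_op v 1 M) N"
      using reduce[OF label_matrix_star_op[OF M]] k(1) by blast
    moreover have "graph_step M (star_op v 1 M)"
      unfolding graph_step_def by blast
    ultimately show ?thesis by (meson converse_rtranclp_into_rtranclp)
  qed
qed

section \<open>Tensor products\<close>

text \<open>By distributivity, a product over qupits of sums over local indices is one sum over all
  index functions.\<close>

lemma tensor_apply_comp: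
  "tensor_apply A (tensor_apply B \<psi>) = tensor_apply (\<lambda>i. mmult (A i) (B i)) \<psi>"
proof (intro ext)
  fix x
  have "tensor_apply A (tensor_apply B \<psi>) x
      = (\<Sum>z\<in>UNIV. \<Sum>y\<in>UNIV. (\<Prod>i\<in>UNIV. A i (x i) (z i)) * (\<Prod>i\<in>UNIV. B i (z i) (y i)) * \<psi> y)"
    by (simp add: tensor_apply_def sum_distrib_left mult.assoc)
  also have "\<dots> = (\<Sum>y\<in>UNIV. (\<Sum>z\<in>UNIV. \<Prod>i\<in>UNIV. A i (x i) (z i) * B i (z i) (y i)) * \<psi> y)"
    by (subst sum.swap) (simp add: sum_distrib_right prod.distrib)
  also have "\<dots> = (\<Sum>y\<in>UNIV. (\<Prod>i\<in>UNIV. mmult (A i) (B i) (x i) (y i)) * \<psi> y)"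
    by (simp add: mmult_def prod_sum_PiE PiE_UNIV_domain)
  finally show "tensor_apply A (tensor_apply B \<psi>) x = tensor_apply (\<lambda>i. mmult (A i) (B i)) \<psi> x"
    by (simp add: tensor_apply_def)
qed

lemma tensor_apply_scale: "tensor_apply U (\<lambda>x. s * \<psi> x) = (\<lambda>x. s * tensor_apply U \<psi> x)"
  by (simp add: tensor_apply_def sum_distrib_left mult_ac)

lemma tensor_apply_scale_ops:
  "tensor_apply (\<lambda>i x y. f i * U i x y) \<psi> = (\<lambda>x. (\<Prod>i\<in>UNIV. f i) * tensor_apply U \<psi> x)"
  by (simp add: tensor_apply_def prod.distrib sum_distrib_left mult_ac)

text \<open>Each row of a factor has at most one nonzero entry, so a single configuration survives
  the sum.\<close>

lemma tensor_apply_monomial: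
  assumes U: "\<And>i r s. U i r s = (if s = f i r then g i r else 0)"
  shows "tensor_apply U \<psi> x = (\<Prod>i\<in>UNIV. g i (x i)) * \<psi> (\<lambda>i. f i (x i))"
proof -
  have "(\<Prod>i\<in>UNIV. U i (x i) (y i)) * \<psi> y
      = (if y = (\<lambda>i. f i (x i)) then (\<Prod>i\<in>UNIV. g i (x i)) * \<psi> (\<lambda>i. f i (x i)) else 0)" for y
  proof (cases "y = (\<lambda>i. f i (x i))")
    case False
    then obtain i where "y i \<noteq> f i (x i)" by blast
    then have "\<exists>i\<in>UNIV. U i (x i) (y i) = 0" by (auto simp: U)
    then have "(\<Prod>i\<in>UNIV. U i (x i) (y i)) = 0" by (intro prod_zero) auto
    with False show ?thesis by simp
  qed (simp add: U)
  then show ?thesis by (simp add: tensor_apply_def)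
qed

text \<open>Only configurations agreeing with \<open>x\<close> away from \<open>v\<close>
  contribute. This serves a chirp at \<open>v\<close> combined with diagonal phases
  elsewhere.\<close>

lemma tensor_apply_diagonal_except:
  assumes U: "\<And>i r s. i \<noteq> v \<Longrightarrow> U i r s = (if s = r then g i r else 0)"
  shows "tensor_apply U \<psi> x
    = (\<Prod>i\<in>UNIV - {v}. g i (x i)) * (\<Sum>s\<in>UNIV. U v (x v) s * \<psi> (x(v := s)))"
proof -
  let ?h = "\<lambda>y. (\<Prod>i\<in>UNIV. U i (x i) (y i)) * \<psi> y"
  have split: "(\<Prod>i\<in>UNIV. U i (x i) (y i)) = U v (x v) (y v) * (\<Prod>i\<in>UNIV - {v}. U i (x i) (y i))" for y
    by (rule prod.remove) auto
  have "?h y = 0" if "y \<in> UNIV - range (\<lambda>s. x(v := s))" for y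
  proof -
    have "y \<noteq> x(v := y v)" using that by blast
    then obtain i where "i \<noteq> v" "y i \<noteq> x i" by (auto simp: fun_eq_iff split: if_splits)
    then have "U i (x i) (y i) = 0" by (simp add: U)
    then have "\<exists>i\<in>UNIV. U i (x i) (y i) = 0" by blast
    then have "(\<Prod>i\<in>UNIV. U i (x i) (y i)) = 0" by (intro prod_zero) auto
    then show ?thesis by simp
  qed
  then have "tensor_apply U \<psi> x = (\<Sum>y\<in>range (\<lambda>s. x(v := s)). ?h y)"
    unfolding tensor_apply_def by (intro sum.mono_neutral_right) auto
  also have "\<dots> = (\<Sum>s\<in>UNIV. ?h (x(v := s)))"
    by (subst sum.reindex) (auto intro!: injI dest: fun_upd_eqD)
  also have "\<dots> = (\<Sum>s\<in>UNIV. (\<Prod>i\<in>UNIV - {v}. g i (x i)) * (U v (x v) s * \<psi> (x(v := s))))"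
    by (intro sum.cong refl) (simp add: split U)
  finally show ?thesis by (simp add: sum_distrib_left)
qed

lemma tensor_apply_id1 [simp]: "tensor_apply (\<lambda>i. id1) \<psi> = \<psi>"
proof
  fix x
  show "tensor_apply (\<lambda>i. id1) \<psi> x = \<psi> x"
    using tensor_apply_monomial[of "\<lambda>i. id1" "\<lambda>i r. r" "\<lambda>i r. 1" \<psi> x]
    by (simp add: id1_def eq_commute)
qed

lemma pauli_apply_eq:
  "pauli_apply c a b \<psi> x = omega_pow (c + (\<Sum>k\<in>UNIV. b k * (x k - a k))) * \<psi> (\<lambda>k. x k - a k)"
proof -
  have "tensor_apply (\<lambda>i. mmult (Xop (a i)) (Zop (b i))) \<psi> x
      = (\<Prod>i\<in>UNIV. omega_pow (b i * (x i - a i))) * \<psi> (\<lambda>i. x i - a i)"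
    by (rule tensor_apply_monomial) (simp add: mmult_Xop_Zop)
  then show ?thesis
    by (simp add: pauli_apply_def omega_pow_add omega_pow_sum)
qed

lemma tensor_apply_clifford_eq_0:
  assumes U: "\<And>i. clifford1 (U i)" and 0: "tensor_apply U \<psi> = (\<lambda>_. 0)"
  shows "\<psi> = (\<lambda>_. 0)"
proof -
  have "\<psi> = tensor_apply (\<lambda>i. mmult (adjoint1 (U i)) (U i)) \<psi>"
    using U by (simp add: clifford1_def unitary1_def)
  also have "\<dots> = tensor_apply (\<lambda>i. adjoint1 (U i)) (tensor_apply U \<psi>)"
    by (rule tensor_apply_comp[symmetric])
  also have "\<dots> = (\<lambda>_. 0)" unfolding 0 by (simp add: tensor_apply_def)
  finally show ?thesis .
qed

text \<open>The local phases multiply to one global phase, which is the same for all states.\<close>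

lemma tensor_apply_pauli_apply:
  fixes U :: "'n::finite \<Rightarrow> 'p::prime_card op1"
  assumes "\<And>i. carries (U i) (u i) (w i) (u' i) (w' i)"
  shows "\<exists>c'. \<forall>\<psi>. tensor_apply U (pauli_apply c u w \<psi>) = pauli_apply c' u' w' (tensor_apply U \<psi>)"
proof -
  let ?P = "\<lambda>a b :: 'p mod_ring. mmult (Xop a) (Zop b) :: 'p op1"
  obtain k :: "'n \<Rightarrow> 'p mod_ring" where k: "\<And>i. mmult (U i) (?P (u i) (w i))
      = (\<lambda>x y. omega_pow (k i) * mmult (?P (u' i) (w' i)) (U i) x y)"
    using assms unfolding carries_iff by metis
  have "tensor_apply U (pauli_apply c u w \<psi>)
      = pauli_apply (c + (\<Sum>i\<in>UNIV. k i)) u' w' (tensor_apply U \<psi>)" for \<psi>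
  proof -
    have "tensor_apply U (pauli_apply c u w \<psi>)
        = (\<lambda>x. omega_pow c * tensor_apply (\<lambda>i. mmult (U i) (?P (u i) (w i))) \<psi> x)"
      unfolding pauli_apply_def tensor_apply_scale tensor_apply_comp ..
    also have "\<dots> = (\<lambda>x. omega_pow c * ((\<Prod>i\<in>UNIV. omega_pow (k i))
        * tensor_apply (\<lambda>i. mmult (?P (u' i) (w' i)) (U i)) \<psi> x))"
      unfolding k tensor_apply_scale_ops ..
    finally show ?thesis
      unfolding pauli_apply_def tensor_apply_comp by (simp add: omega_pow_add omega_pow_sum mult.assoc)
  qed
  then show ?thesis by blast
qed

section \<open>Amplitudes of graph states\<close>

text \<open>The stabilizer equation is read as a recursion for the amplitudes along coordinate
  \<open>i\<close>.\<close>

lemma graph_state_shift: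
  fixes M :: "'n::finite \<Rightarrow> 'n \<Rightarrow> 'p::prime_card mod_ring"
  assumes "pauli_apply c (unit_vec i) (M i) \<psi> = \<psi>"
  shows "\<psi> (x(i := x i + 1)) = omega_pow (c + (\<Sum>k\<in>UNIV. M i k * x k)) * \<psi> x"
proof -
  have shift: "(x(i := x i + 1)) k - unit_vec i k = x k" for k
    by (simp add: unit_vec_def)
  show ?thesis
    using fun_cong[OF assms, of "x(i := x i + 1)"] unfolding pauli_apply_eq shift by simp
qed

text \<open>Repeated unit shifts reach every value of a coordinate, so the coordinates can be reset
  to 0 one after another.\<close>

lemma unit_shift_invariant_const:
  fixes f :: "('n::finite \<Rightarrow> 'p::prime_card mod_ring) \<Rightarrow> 'a"
  assumes "\<And>x i. f (x(i := x i + 1)) = f x"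
  shows "f x = f (\<lambda>_. 0)"
proof -
  have *: "f (x(i := x i + of_nat k)) = f x" for x i k
  proof (induction k)
    case (Suc k)
    show ?case
      using assms[of "x(i := x i + of_nat k)" i] Suc
      unfolding fun_upd_same fun_upd_upd of_nat_Suc add.commute[of 1] add.assoc[symmetric] by (simp only:)
  qed simp
  have upd: "f (x(i := t)) = f x" for x i t
  proof -
    obtain k where "t - x i = of_nat k" using surj_of_nat_mod_ring by blast
    then show ?thesis using *[of x i k] by (metis add.commute diff_add_cancel)
  qed
  have "f (\<lambda>i. if i \<in> A then 0 else x i) = f x" if "finite A" for A
    using that
  proof (induction A rule: finite_induct)
    case (insert j A)
    have "(\<lambda>i. if i \<in> insert j A then 0 else x i) = (\<lambda>i. if i \<in> A then 0 else x i)(j := 0)"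
      by auto
    then show ?case using insert.IH upd by metis
  qed simp
  from this[of UNIV] show ?thesis by simp
qed

text \<open>For a label matrix the double sum meets each edge twice; the division by 2, meaningful
  for odd p, makes it count once.\<close>

definition quad_form :: "('n::finite \<Rightarrow> 'n \<Rightarrow> 'p::prime_card mod_ring) \<Rightarrow> ('n \<Rightarrow> 'p mod_ring) \<Rightarrow> 'p mod_ring" where
  "quad_form M x = (\<Sum>j\<in>UNIV. (\<Sum>l\<in>UNIV. M j l * x l) * x j) / 2"

text \<open>The linear term \<open>l\<close> records the phases of the generators, which the label
  matrix does not determine.\<close>

definition graph_vec :: "('n::finite \<Rightarrow> 'n \<Rightarrow> 'p::prime_card mod_ring) \<Rightarrow> ('n \<Rightarrow> 'p mod_ring)
    \<Rightarrow> ('n \<Rightarrow> 'p mod_ring) \<Rightarrow> complex" where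
  "graph_vec M l x = omega_pow (quad_form M x + (\<Sum>k\<in>UNIV. l k * x k))"

lemma two_neq_0:
  assumes "odd CARD('p)"
  shows "(2 :: 'p::prime_card mod_ring) \<noteq> 0"
proof
  assume "(2 :: 'p mod_ring) = 0"
  then have "CARD('p) dvd 2"
    using of_nat_0_mod_ring_dvd[of 2, where 'a='p] by simp
  then have "CARD('p) \<le> 2" by (rule dvd_imp_le) simp
  moreover have "CARD('p) > 1" by (rule nontriv)
  ultimately show False using assms by (cases "CARD('p) = 2") auto
qed

text \<open>The zero diagonal kills the term in t^2; symmetry doubles the linear term, which cancels
  the division by 2.\<close>

lemma quad_form_fun_upd:
  fixes M :: "'n::finite \<Rightarrow> 'n \<Rightarrow> 'p::prime_card mod_ring"
  assumes p: "odd CARD('p)" and M: "label_matrix M"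
  shows "quad_form M (x(v := x v + t)) = quad_form M x + t * (\<Sum>k\<in>UNIV. M v k * x k)"
proof -
  let ?m = "\<Sum>k\<in>UNIV. M v k * x k"
  have Mvv: "M v v = 0" and sym: "\<And>j. M j v = M v j" using M by (auto simp: label_matrix_def)
  have "(\<Sum>j\<in>UNIV. ((\<Sum>l\<in>UNIV. M j l * x l) + M j v * t) * x j)
      = (\<Sum>j\<in>UNIV. (\<Sum>l\<in>UNIV. M j l * x l) * x j) + t * ?m"
    unfolding sym distrib_right sum.distrib by (simp add: sum_distrib_left mult_ac)
  then have "(\<Sum>j\<in>UNIV. (\<Sum>l\<in>UNIV. M j l * (x(v := x v + t)) l) * (x(v := x v + t)) j)
      = (\<Sum>j\<in>UNIV. (\<Sum>l\<in>UNIV. M j l * x l) * x j) + 2 * (t * ?m)"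
    using sum_mult_fun_upd[of "\<lambda>j. (\<Sum>l\<in>UNIV. M j l * x l) + M j v * t" x v t]
    unfolding sum_mult_fun_upd[of "M _" x v t] by (simp add: Mvv del: fun_upd_apply)
  then show ?thesis
    using two_neq_0[OF p] unfolding quad_form_def by (simp add: add_divide_distrib)
qed

text \<open>The state and \<open>graph_vec M l\<close> satisfy the same recursion when
  \<open>l\<close> holds the generator phases, so their quotient is invariant under unit shifts and
  hence constant.\<close>

lemma graph_state_eq_graph_vec:
  fixes M :: "'n::finite \<Rightarrow> 'n \<Rightarrow> 'p::prime_card mod_ring"
  assumes p: "odd CARD('p)" and M: "label_matrix M" and \<psi>: "graph_state M \<psi>"
  shows "\<exists>K l. K \<noteq> 0 \<and> \<psi> = (\<lambda>x. K * graph_vec M l x)"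
proof -
  from \<psi> obtain l where l: "\<And>i. pauli_apply (l i) (unit_vec i) (M i) \<psi> = \<psi>" and nz: "\<psi> \<noteq> (\<lambda>_. 0)"
    unfolding graph_state_def by blast
  let ?f = "\<lambda>x. \<psi> x / graph_vec M l x"
  have "?f (x(i := x i + 1)) = ?f x" for x i
  proof -
    have "graph_vec M l (x(i := x i + 1)) = omega_pow (l i + (\<Sum>k\<in>UNIV. M i k * x k)) * graph_vec M l x"
      unfolding graph_vec_def quad_form_fun_upd[OF p M] sum_mult_fun_upd
      by (simp add: add_ac flip: omega_pow_add)
    then show ?thesis by (simp add: graph_state_shift[of _ _ M, OF l])
  qed
  then have "?f x = ?f (\<lambda>_. 0)" for x by (rule unit_shift_invariant_const)
  then have \<psi>_eq: "\<psi> x = ?f (\<lambda>_. 0) * graph_vec M l x" for x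
    by (simp add: graph_vec_def field_simps)
  moreover have "?f (\<lambda>_. 0) \<noteq> 0"
    using nz \<psi>_eq by force
  ultimately show ?thesis by blast
qed

lemma graph_state_at_0:
  fixes M :: "'n::finite \<Rightarrow> 'n \<Rightarrow> 'p::prime_card mod_ring"
  assumes "odd CARD('p)" "label_matrix M" "graph_state M \<psi>"
  shows "\<psi> (\<lambda>_. 0) \<noteq> 0"
  using graph_state_eq_graph_vec[OF assms] by (auto simp: graph_vec_def)

text \<open>The amplitude at u + e_j is computed from the one at 0 in two ways: through the given
  Pauli operator and generator j at 0, or through generator j at u and then the Pauli
  operator.\<close>

lemma graph_state_stabilizer:
  fixes N :: "'n::finite \<Rightarrow> 'n \<Rightarrow> 'p::prime_card mod_ring"
  assumes p: "odd CARD('p)" and N: "label_matrix N" and \<phi>: "graph_state N \<phi>"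
    and stab: "pauli_apply k u w \<phi> = \<phi>"
  shows "w j = (\<Sum>l\<in>UNIV. N j l * u l)"
proof -
  from \<phi> obtain c where c: "\<And>i. pauli_apply (c i) (unit_vec i) (N i) \<phi> = \<phi>"
    unfolding graph_state_def by blast
  note shift = graph_state_shift[of _ _ N, OF c]
  let ?Nu = "\<Sum>l\<in>UNIV. N j l * u l"
  \<comment> \<open>The value stays \<open>0 + 1\<close> so that the recursion at the zero vector
    matches literally.\<close>
  have diff: "(\<lambda>i. (u(j := u j + 1)) i - u i) = (\<lambda>_. 0)(j := 0 + 1)" by auto
  have "(\<Sum>i\<in>UNIV. w i * ((u(j := u j + 1)) i - u i)) = w j"
    unfolding sum_mult_fun_upd right_diff_distrib sum_subtractf by simp
  then have "\<phi> (u(j := u j + 1)) = omega_pow (k + w j) * (omega_pow (c j) * \<phi> (\<lambda>_. 0))"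
    using fun_cong[OF stab, of "u(j := u j + 1)"] shift[of "\<lambda>_. 0" j]
    unfolding pauli_apply_eq diff by simp
  moreover have "\<phi> u = omega_pow k * \<phi> (\<lambda>_. 0)"
    using fun_cong[OF stab, of u] unfolding pauli_apply_eq by simp
  ultimately have "omega_pow (k + w j + c j) * \<phi> (\<lambda>_. 0) = omega_pow (c j + ?Nu + k) * \<phi> (\<lambda>_. 0)"
    using shift[of u j] by (auto simp: omega_pow_add mult.assoc)
  then show ?thesis
    using graph_state_at_0[OF p N \<phi>] by (simp add: algebra_simps)
qed

text \<open>The images of the generators of the first state stabilize the second, so their labels
  lie in the row space of (Id | N). Linearity extends this from basis vectors to all x.\<close>

lemma LC_equiv_imp_local_symplectic:
  fixes M N :: "'n::finite \<Rightarrow> 'n \<Rightarrow> 'p::prime_card mod_ring"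
  assumes p: "odd CARD('p)" and M: "label_matrix M" and N: "label_matrix N"
    and \<psi>: "graph_state M \<psi>" and \<phi>: "graph_state N \<phi>" and LC: "LC_equiv \<psi> \<phi>"
  shows "\<exists>a b c d. local_symplectic M N a b c d"
proof -
  from LC obtain U s where U: "\<And>i. clifford1 (U i)" and s: "tensor_apply U \<psi> = (\<lambda>x. s * \<phi> x)"
    unfolding LC_equiv_def by blast
  \<comment> \<open>A tensor product of unitaries cannot annihilate the nonzero state.\<close>
  have "s \<noteq> 0"
    using tensor_apply_clifford_eq_0[of U \<psi>] U s \<psi> by (auto simp: graph_state_def)
  have "\<forall>i. \<exists>a b c d. a * d - b * c = 1 \<and> (\<forall>m n. carries (U i) m n (a * m + b * n) (c * m + d * n))"
    using clifford1_symplectic[OF U] by blast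
  then obtain a b c d where det: "\<And>i. a i * d i - b i * c i = 1"
    and car: "\<And>i m n. carries (U i) m n (a i * m + b i * n) (c i * m + d i * n)"
    by metis
  let ?u = "\<lambda>i k. a k * unit_vec i k + b k * M i k" and ?w = "\<lambda>i k. c k * unit_vec i k + d k * M i k"
  have gen: "?w i j = (\<Sum>k\<in>UNIV. N j k * ?u i k)" for i j
  proof -
    from \<psi> obtain e where e: "pauli_apply e (unit_vec i) (M i) \<psi> = \<psi>"
      unfolding graph_state_def by blast
    obtain e' where "\<And>\<psi>. tensor_apply U (pauli_apply e (unit_vec i) (M i) \<psi>)
        = pauli_apply e' (?u i) (?w i) (tensor_apply U \<psi>)"
      using tensor_apply_pauli_apply[of U "unit_vec i" "M i" "?u i" "?w i" e, OF car] by blast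
    from this[of \<psi>] have "pauli_apply e' (?u i) (?w i) (\<lambda>x. s * \<phi> x) = (\<lambda>x. s * \<phi> x)"
      by (simp add: e s)
    then have "pauli_apply e' (?u i) (?w i) \<phi> = \<phi>"
      using \<open>s \<noteq> 0\<close> by (simp add: fun_eq_iff pauli_apply_eq mult.left_commute)
    then show ?thesis by (rule graph_state_stabilizer[OF p N \<phi>])
  qed
  have basis: "f k * x k + g k * (\<Sum>l\<in>UNIV. M k l * x l)
      = (\<Sum>i\<in>UNIV. x i * (f k * unit_vec i k + g k * M i k))" for f g x k
  proof -
    have "(\<Sum>i\<in>UNIV. x i * (f k * unit_vec i k)) = f k * x k"
      by (simp add: unit_vec_def if_distrib[of "\<lambda>t. _ * t"] mult.commute cong: if_cong)
    moreover have "(\<Sum>i\<in>UNIV. x i * (g k * M i k)) = g k * (\<Sum>l\<in>UNIV. M k l * x l)"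
      using M by (simp add: label_matrix_def sum_distrib_left mult_ac)
    ultimately show ?thesis by (simp add: distrib_left sum.distrib)
  qed
  have "(\<Sum>k\<in>UNIV. N j k * (a k * x k + b k * (\<Sum>l\<in>UNIV. M k l * x l)))
      = c j * x j + d j * (\<Sum>l\<in>UNIV. M j l * x l)" for x j
  proof -
    have "(\<Sum>k\<in>UNIV. N j k * (a k * x k + b k * (\<Sum>l\<in>UNIV. M k l * x l)))
        = (\<Sum>k\<in>UNIV. \<Sum>i\<in>UNIV. x i * (N j k * ?u i k))"
      unfolding basis by (simp add: sum_distrib_left mult.left_commute)
    also have "\<dots> = (\<Sum>i\<in>UNIV. x i * (\<Sum>k\<in>UNIV. N j k * ?u i k))"
      by (subst sum.swap) (simp add: sum_distrib_left)
    also have "\<dots> = (\<Sum>i\<in>UNIV. x i * ?w i j)" by (simp only: gen)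
    finally show ?thesis unfolding basis .
  qed
  with det have "local_symplectic M N a b c d" unfolding local_symplectic_def by blast
  then show ?thesis by blast
qed

section \<open>Clifford operators realising the graph operations\<close>

definition quad_phase_op :: "'p::prime_card mod_ring \<Rightarrow> 'p mod_ring \<Rightarrow> 'p op1" where
  "quad_phase_op \<alpha> \<beta> = (\<lambda>x y. if y = x then omega_pow (\<alpha> * x\<^sup>2 + \<beta> * x) else 0)"

text \<open>The factor sits on the column index, so the operator acts on amplitudes by substituting
  b x for x.\<close>

definition dilation_op :: "'p::prime_card mod_ring \<Rightarrow> 'p op1" where
  "dilation_op b = (\<lambda>x y. if y = b * x then 1 else 0)"

text \<open>Convolution with a quadratic phase, normalised to be unitary for odd p and nonzero
  \<gamma>. It then induces the matrix (1 1/(2\<gamma>); 0 1) on Pauli labels.\<close>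

definition chirp_op :: "'p::prime_card mod_ring \<Rightarrow> 'p op1" where
  "chirp_op \<gamma> = (\<lambda>x y. omega_pow (\<gamma> * (x - y)\<^sup>2) / of_real (sqrt (of_nat CARD('p))))"

text \<open>Expanding the quadratic phase about x - a leaves a linear phase, so the induced map is
  the shear b -> b + 2 \<alpha> a.\<close>

lemma clifford1_quad_phase_op: "clifford1 (quad_phase_op \<alpha> \<beta>)"
proof (rule clifford1I)
  have cnj_if: "cnj (if P then a else 0) = (if P then cnj a else 0)" for P a by simp
  show "unitary1 (quad_phase_op \<alpha> \<beta>)"
    unfolding unitary1_def
  proof (intro conjI ext)
    fix x y
    have "mmult (quad_phase_op \<alpha> \<beta>) (adjoint1 (quad_phase_op \<alpha> \<beta>)) x y
        = (\<Sum>z\<in>UNIV. if z = x then id1 x y else 0)"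
      unfolding mmult_def adjoint1_def quad_phase_op_def id1_def cnj_if
      by (rule sum.cong) (auto simp: cnj_omega_pow simp del: minus_add_distrib)
    then show "mmult (quad_phase_op \<alpha> \<beta>) (adjoint1 (quad_phase_op \<alpha> \<beta>)) x y = id1 x y" by simp
    have "mmult (adjoint1 (quad_phase_op \<alpha> \<beta>)) (quad_phase_op \<alpha> \<beta>) x y
        = (\<Sum>z\<in>UNIV. if z = x then id1 x y else 0)"
      unfolding mmult_def adjoint1_def quad_phase_op_def id1_def cnj_if
      by (rule sum.cong) (auto simp: cnj_omega_pow mult.commute[of "omega_pow (- _)"] simp del: minus_add_distrib)
    then show "mmult (adjoint1 (quad_phase_op \<alpha> \<beta>)) (quad_phase_op \<alpha> \<beta>) x y = id1 x y" by simp
  qed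
  fix a b
  have "carries (quad_phase_op \<alpha> \<beta>) a b a (b + 2 * \<alpha> * a)"
    unfolding carries_def
  proof (intro exI allI)
    fix x y
    show "quad_phase_op \<alpha> \<beta> x (y + a) * omega_pow (b * y)
        = omega_pow ((\<alpha> * a\<^sup>2 + \<beta> * a) + (b + 2 * \<alpha> * a) * (x - a)) * quad_phase_op \<alpha> \<beta> (x - a) y"
      by (auto simp: quad_phase_op_def power2_eq_square algebra_simps simp flip: omega_pow_add)
  qed
  then show "\<exists>a' b'. carries (quad_phase_op \<alpha> \<beta>) a b a' b'" by blast
qed

lemma clifford1_dilation_op:
  assumes "t \<noteq> 0"
  shows "clifford1 (dilation_op t)"
proof (rule clifford1I)
  have cnj_if: "cnj (if P then 1 else 0) = (if P then 1 else 0)" for P by simp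
  show "unitary1 (dilation_op t)"
    unfolding unitary1_def
  proof (intro conjI ext)
    fix x y
    have "mmult (dilation_op t) (adjoint1 (dilation_op t)) x y
        = (\<Sum>z\<in>UNIV. if z = t * x then id1 x y else 0)"
      unfolding mmult_def adjoint1_def dilation_op_def id1_def cnj_if
      using assms by (intro sum.cong) auto
    then show "mmult (dilation_op t) (adjoint1 (dilation_op t)) x y = id1 x y" by simp
    have "mmult (adjoint1 (dilation_op t)) (dilation_op t) x y
        = (\<Sum>z\<in>UNIV. if z = x / t then id1 x y else 0)"
      unfolding mmult_def adjoint1_def dilation_op_def id1_def cnj_if
      using assms by (intro sum.cong) (auto simp: field_simps)
    then show "mmult (adjoint1 (dilation_op t)) (dilation_op t) x y = id1 x y" by simp
  qed
  fix a b
  have "carries (dilation_op t) a b (a / t) (b * t)"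
    unfolding carries_def
  proof (intro exI allI)
    fix x y
    have "y + a = t * x \<longleftrightarrow> y = t * (x - a / t)"
      using assms by (simp add: right_diff_distrib eq_diff_eq)
    then show "dilation_op t x (y + a) * omega_pow (b * y)
        = omega_pow (0 + b * t * (x - a / t)) * dilation_op t (x - a / t) y"
      by (simp add: dilation_op_def mult.assoc)
  qed
  then show "\<exists>a' b'. carries (dilation_op t) a b a' b'" by blast
qed

lemma clifford1_chirp_op:
  fixes \<gamma> :: "'p::prime_card mod_ring"
  assumes p: "odd CARD('p)" and "\<gamma> \<noteq> 0"
  shows "clifford1 (chirp_op \<gamma>)"
proof (rule clifford1I)
  note two = two_neq_0[OF p]
  let ?r = "of_real (sqrt (of_nat CARD('p))) :: complex"
  have r: "?r * ?r = of_nat CARD('p)"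
    by (simp flip: of_real_mult)
  \<comment> \<open>Unitarity is orthogonality of characters: the squares of z cancel in each
    product of entries, leaving a phase linear in z.\<close>
  have phase: "(\<Sum>z\<in>UNIV. omega_pow (e + k * z) / (?r * ?r)) = (if k = 0 then omega_pow e else 0)"
    for e k :: "'p mod_ring"
  proof -
    have "(\<Sum>z\<in>UNIV. omega_pow (e + k * z) / (?r * ?r))
        = omega_pow e * (\<Sum>z\<in>UNIV. omega_pow (k * z)) / (?r * ?r)"
      by (simp add: omega_pow_add sum_distrib_left sum_divide_distrib)
    then show ?thesis unfolding r sum_omega_pow by simp
  qed
  show "unitary1 (chirp_op \<gamma>)"
    unfolding unitary1_def
  proof (intro conjI ext)
    fix x y
    have "mmult (chirp_op \<gamma>) (adjoint1 (chirp_op \<gamma>)) x y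
        = (\<Sum>z\<in>UNIV. omega_pow (\<gamma> * (x\<^sup>2 - y\<^sup>2) + (- 2 * \<gamma> * (x - y)) * z) / (?r * ?r))"
      unfolding mmult_def adjoint1_def chirp_op_def
      by (intro sum.cong)
        (auto simp: cnj_omega_pow power2_eq_square algebra_simps simp flip: omega_pow_add)
    then show "mmult (chirp_op \<gamma>) (adjoint1 (chirp_op \<gamma>)) x y = id1 x y"
      unfolding phase using assms two by (simp add: id1_def)
    have "mmult (adjoint1 (chirp_op \<gamma>)) (chirp_op \<gamma>) x y
        = (\<Sum>z\<in>UNIV. omega_pow (\<gamma> * (y\<^sup>2 - x\<^sup>2) + (2 * \<gamma> * (x - y)) * z) / (?r * ?r))"
      unfolding mmult_def adjoint1_def chirp_op_def
      by (intro sum.cong)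
        (auto simp: cnj_omega_pow power2_eq_square algebra_simps simp flip: omega_pow_add)
    then show "mmult (adjoint1 (chirp_op \<gamma>)) (chirp_op \<gamma>) x y = id1 x y"
      unfolding phase using assms two by (simp add: id1_def)
  qed
  fix a b
  \<comment> \<open>This is the shift of the X label that absorbs the factor
    \<open>omega_pow (b * y)\<close> when the square in y is completed.\<close>
  define e where "e = b / (2 * \<gamma>)"
  have b: "b = 2 * \<gamma> * e" using assms two by (simp add: e_def)
  have "carries (chirp_op \<gamma>) a b (a + e) b"
    unfolding carries_def
  proof (intro exI allI)
    fix x y
    have "\<gamma> * (x - (y + a))\<^sup>2 + b * y
        = (b * e - \<gamma> * e\<^sup>2) + b * (x - (a + e)) + \<gamma> * (x - (a + e) - y)\<^sup>2"
      unfolding b by (simp add: power2_eq_square algebra_simps)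
    then show "chirp_op \<gamma> x (y + a) * omega_pow (b * y)
        = omega_pow ((b * e - \<gamma> * e\<^sup>2) + b * (x - (a + e))) * chirp_op \<gamma> (x - (a + e)) y"
      by (simp add: chirp_op_def flip: omega_pow_add)
  qed
  then show "\<exists>a' b'. carries (chirp_op \<gamma>) a b a' b'" by blast
qed

section \<open>Local Clifford equivalence of graph vectors\<close>

lemma LC_equivI:
  assumes "\<And>i. clifford1 (U i)" "\<And>x. tensor_apply U \<psi> x = s * \<phi> x"
  shows "LC_equiv \<psi> \<phi>"
  unfolding LC_equiv_def using assms by (intro exI[of _ U] exI[of _ s]) auto

lemma LC_equiv_trans:
  assumes "LC_equiv \<psi> \<phi>" "LC_equiv \<phi> \<chi>"
  shows "LC_equiv \<psi> \<chi>"
proof -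
  obtain U s where U: "\<And>i. clifford1 (U i)" "tensor_apply U \<psi> = (\<lambda>x. s * \<phi> x)"
    using assms(1) unfolding LC_equiv_def by blast
  obtain V t where V: "\<And>i. clifford1 (V i)" "tensor_apply V \<phi> = (\<lambda>x. t * \<chi> x)"
    using assms(2) unfolding LC_equiv_def by blast
  have "tensor_apply (\<lambda>i. mmult (V i) (U i)) \<psi> = (\<lambda>x. (s * t) * \<chi> x)"
    unfolding tensor_apply_comp[symmetric] U V tensor_apply_scale by (simp add: mult.assoc)
  then show ?thesis
    using clifford1_mmult[OF V(1) U(1)] by (intro LC_equivI[of "\<lambda>i. mmult (V i) (U i)"]) auto
qed

lemma LC_equiv_scale:
  assumes "LC_equiv \<psi> \<phi>" "t \<noteq> 0"
  shows "LC_equiv (\<lambda>x. k * \<psi> x) (\<lambda>x. t * \<phi> x)"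
proof -
  obtain U s where U: "\<And>i. clifford1 (U i)" "tensor_apply U \<psi> = (\<lambda>x. s * \<phi> x)"
    using assms(1) unfolding LC_equiv_def by blast
  have "tensor_apply U (\<lambda>x. k * \<psi> x) = (\<lambda>x. (k * s / t) * (t * \<phi> x))"
    unfolding U tensor_apply_scale using assms(2) by simp
  then show ?thesis using U(1) unfolding LC_equiv_def by blast
qed

text \<open>The operator \<open>quad_phase_op 0 t\<close> is Z(t), so local Z operators adjust the
  linear phases.\<close>

lemma LC_equiv_graph_vec: "LC_equiv (graph_vec M l) (graph_vec M l')"
proof -
  have "tensor_apply (\<lambda>i. quad_phase_op 0 (l' i - l i)) (graph_vec M l) x = 1 * graph_vec M l' x" for x
  proof -
    have "tensor_apply (\<lambda>i. quad_phase_op 0 (l' i - l i)) (graph_vec M l) x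
        = (\<Prod>i\<in>UNIV. omega_pow (0 * (x i)\<^sup>2 + (l' i - l i) * x i)) * graph_vec M l (\<lambda>i. x i)"
      by (rule tensor_apply_monomial[where f = "\<lambda>i r. r" and g = "\<lambda>i r. omega_pow (0 * r\<^sup>2 + (l' i - l i) * r)"])
        (simp add: quad_phase_op_def)
    then show ?thesis
      unfolding omega_pow_sum[symmetric] graph_vec_def omega_pow_add[symmetric]
      by (simp add: left_diff_distrib sum_subtractf)
  qed
  then show ?thesis by (rule LC_equivI[OF clifford1_quad_phase_op])
qed

lemma LC_equiv_circ_op:
  assumes "b \<noteq> 0"
  shows "LC_equiv (graph_vec M (\<lambda>_. 0)) (graph_vec (circ_op v b M) (\<lambda>_. 0))"
proof -
  let ?d = "\<lambda>i. if i = v then b else 1"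
  have "tensor_apply (\<lambda>i. dilation_op (?d i)) (graph_vec M (\<lambda>_. 0)) x
      = 1 * graph_vec (circ_op v b M) (\<lambda>_. 0) x" for x
  proof -
    have "tensor_apply (\<lambda>i. dilation_op (?d i)) (graph_vec M (\<lambda>_. 0)) x
        = (\<Prod>i\<in>UNIV. 1) * graph_vec M (\<lambda>_. 0) (\<lambda>i. ?d i * x i)"
      using tensor_apply_monomial[where U = "\<lambda>i. dilation_op (?d i)" and f = "\<lambda>i r. ?d i * r" and g = "\<lambda>i r. 1"]
      by (simp add: dilation_op_def)
    moreover have "quad_form (circ_op v b M) x = quad_form M (\<lambda>i. ?d i * x i)"
      unfolding quad_form_def circ_op_def Let_def sum_distrib_right
      by (intro arg_cong[where f = "\<lambda>t. t / 2"] sum.cong refl) (simp only: mult_ac)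
    ultimately show ?thesis by (simp add: graph_vec_def)
  qed
  moreover have "clifford1 (dilation_op (?d i))" for i
    using assms by (intro clifford1_dilation_op) auto
  ultimately show ?thesis by (intro LC_equivI)
qed

text \<open>The rank-one update contributes the square of one linear form, and the zeroed diagonal
  contributes a sum of single-vertex terms. A chirp at \<open>v\<close> supplies the former and
  diagonal operators the latter.\<close>

lemma quad_form_star_op:
  fixes M :: "'n::finite \<Rightarrow> 'n \<Rightarrow> 'p::prime_card mod_ring"
  assumes M: "label_matrix M"
  shows "quad_form (star_op v s M) x = quad_form M x + s / 2 * (\<Sum>k\<in>UNIV. M v k * x k)\<^sup>2
    + (\<Sum>i\<in>UNIV. - (s / 2) * (M v i)\<^sup>2 * (x i)\<^sup>2)"
proof -
  define m where "m = (\<Sum>k\<in>UNIV. M v k * x k)"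
  have "(\<Sum>j\<in>UNIV. (\<Sum>l\<in>UNIV. star_op v s M j l * x l) * x j)
      = (\<Sum>j\<in>UNIV. (\<Sum>l\<in>UNIV. M j l * x l) * x j + s * m * (M v j * x j) - s * (M v j)\<^sup>2 * (x j)\<^sup>2)"
    unfolding star_op_mult_vec[OF M] m_def[symmetric]
    by (intro sum.cong refl) (simp add: power2_eq_square algebra_simps)
  also have "\<dots> = (\<Sum>j\<in>UNIV. (\<Sum>l\<in>UNIV. M j l * x l) * x j) + s * m * m - (\<Sum>j\<in>UNIV. s * (M v j)\<^sup>2 * (x j)\<^sup>2)"
    unfolding sum_subtractf sum.distrib sum_distrib_left[symmetric] m_def ..
  finally show ?thesis
    unfolding quad_form_def m_def[symmetric]
    by (simp add: add_divide_distrib diff_divide_distrib power2_eq_square sum_divide_distrib sum_negf mult.assoc)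
qed

text \<open>Completing the square in the convolution of the amplitudes with a chirp in the coordinate \<open>v\<close>
  produces the phase \<open>s/2 (M\<^sub>v \<cdot> x)\<^sup>2\<close>; the diagonal operators remove its terms in the \<open>x\<^sub>i\<^sup>2\<close>.\<close>

lemma LC_equiv_star_op:
  fixes M :: "'n::finite \<Rightarrow> 'n \<Rightarrow> 'p::prime_card mod_ring"
  assumes p: "odd CARD('p)" and M: "label_matrix M"
  shows "LC_equiv (graph_vec M (\<lambda>_. 0)) (graph_vec (star_op v s M) (\<lambda>_. 0))"
proof (cases "s = 0")
  case True
  then have "star_op v s M = M"
    using M by (auto simp: star_op_def label_matrix_def fun_eq_iff)
  then show ?thesis by (simp add: LC_equiv_graph_vec)
next
  case False
  note two = two_neq_0[OF p]
  \<comment> \<open>Completing the square in \<gamma> u^2 + u m leaves -m^2 / (4 \<gamma>), which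
    equals s/2 m^2 for this value.\<close>
  define \<gamma> where "\<gamma> = - 1 / (2 * s)"
  have \<gamma>: "\<gamma> \<noteq> 0" "2 * \<gamma> * s = - 1" using False two by (simp_all add: \<gamma>_def)
  let ?U = "\<lambda>i. if i = v then chirp_op \<gamma> else quad_phase_op (- (s / 2) * (M v i)\<^sup>2) 0"
  let ?r = "of_real (sqrt (of_nat CARD('p))) :: complex"
  \<comment> \<open>A normalised quadratic Gauss sum; it does not depend on x and becomes the scalar
    of the equivalence.\<close>
  let ?G = "\<Sum>u\<in>UNIV. omega_pow (\<gamma> * u\<^sup>2) / ?r"
  have "tensor_apply ?U (graph_vec M (\<lambda>_. 0)) x = ?G * graph_vec (star_op v s M) (\<lambda>_. 0) x" for x
  proof -
    define m where "m = (\<Sum>k\<in>UNIV. M v k * x k)"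
    have square: "\<gamma> * u\<^sup>2 + u * m = s / 2 * m\<^sup>2 + \<gamma> * (u - s * m)\<^sup>2" for u
    proof -
      have "2 * (s / 2 * m\<^sup>2 + \<gamma> * (u - s * m)\<^sup>2)
          = s * m\<^sup>2 + 2 * \<gamma> * u\<^sup>2 - 2 * (2 * \<gamma> * s) * u * m + (2 * \<gamma> * s) * s * m\<^sup>2"
        using two by (simp add: power2_eq_square algebra_simps)
      also have "\<dots> = 2 * (\<gamma> * u\<^sup>2 + u * m)"
        unfolding \<gamma> by (simp add: algebra_simps)
      finally show ?thesis using two by (simp only: mult_left_cancel simp_thms)
    qed
    have "(\<Prod>i\<in>UNIV - {v}. omega_pow (- (s / 2) * (M v i)\<^sup>2 * (x i)\<^sup>2 + 0 * x i))
        = omega_pow (\<Sum>i\<in>UNIV - {v}. - (s / 2) * (M v i)\<^sup>2 * (x i)\<^sup>2)"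
      by (simp add: omega_pow_sum)
    \<comment> \<open>The term at \<open>v\<close> may be added because
      \<open>M v v = 0\<close>.\<close>
    also have "(\<Sum>i\<in>UNIV - {v}. - (s / 2) * (M v i)\<^sup>2 * (x i)\<^sup>2) = (\<Sum>i\<in>UNIV. - (s / 2) * (M v i)\<^sup>2 * (x i)\<^sup>2)"
      using M by (intro sum.mono_neutral_left) (auto simp: label_matrix_def)
    finally have diag: "(\<Prod>i\<in>UNIV - {v}. omega_pow (- (s / 2) * (M v i)\<^sup>2 * (x i)\<^sup>2 + 0 * x i))
        = omega_pow (\<Sum>i\<in>UNIV. - (s / 2) * (M v i)\<^sup>2 * (x i)\<^sup>2)" .
    have "(\<Sum>t\<in>UNIV. chirp_op \<gamma> (x v) t * graph_vec M (\<lambda>_. 0) (x(v := t)))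
        = (\<Sum>u\<in>UNIV. chirp_op \<gamma> (x v) (x v + u) * graph_vec M (\<lambda>_. 0) (x(v := x v + u)))"
      by (rule sum.reindex_bij_witness[of _ "\<lambda>u. x v + u" "\<lambda>t. t - x v"]) auto
    also have "\<dots> = (\<Sum>u\<in>UNIV. omega_pow (quad_form M x + s / 2 * m\<^sup>2) * (omega_pow (\<gamma> * (u - s * m)\<^sup>2) / ?r))"
    proof (intro sum.cong refl)
      fix u
      have "\<gamma> * (x v - (x v + u))\<^sup>2 + (quad_form M x + u * m)
          = quad_form M x + s / 2 * m\<^sup>2 + \<gamma> * (u - s * m)\<^sup>2"
        using square[of u] by (simp add: add_ac)
      then show "chirp_op \<gamma> (x v) (x v + u) * graph_vec M (\<lambda>_. 0) (x(v := x v + u))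
          = omega_pow (quad_form M x + s / 2 * m\<^sup>2) * (omega_pow (\<gamma> * (u - s * m)\<^sup>2) / ?r)"
        unfolding chirp_op_def graph_vec_def quad_form_fun_upd[OF p M] m_def[symmetric]
        by (simp flip: omega_pow_add)
    qed
    also have "\<dots> = omega_pow (quad_form M x + s / 2 * m\<^sup>2) * (\<Sum>u\<in>UNIV. omega_pow (\<gamma> * (u - s * m)\<^sup>2) / ?r)"
      by (rule sum_distrib_left[symmetric])
    also have "(\<Sum>u\<in>UNIV. omega_pow (\<gamma> * (u - s * m)\<^sup>2) / ?r) = ?G"
      by (rule sum.reindex_bij_witness[of _ "\<lambda>u. u + s * m" "\<lambda>u. u - s * m"]) auto
    finally have conv: "(\<Sum>t\<in>UNIV. chirp_op \<gamma> (x v) t * graph_vec M (\<lambda>_. 0) (x(v := t)))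
        = omega_pow (quad_form M x + s / 2 * m\<^sup>2) * ?G" .
    have "tensor_apply ?U (graph_vec M (\<lambda>_. 0)) x
        = (\<Prod>i\<in>UNIV - {v}. omega_pow (- (s / 2) * (M v i)\<^sup>2 * (x i)\<^sup>2 + 0 * x i))
          * (\<Sum>t\<in>UNIV. ?U v (x v) t * graph_vec M (\<lambda>_. 0) (x(v := t)))"
      by (rule tensor_apply_diagonal_except[where g = "\<lambda>i r. omega_pow (- (s / 2) * (M v i)\<^sup>2 * r\<^sup>2 + 0 * r)"])
        (simp add: quad_phase_op_def)
    also have "\<dots> = omega_pow (\<Sum>i\<in>UNIV. - (s / 2) * (M v i)\<^sup>2 * (x i)\<^sup>2)
        * (omega_pow (quad_form M x + s / 2 * m\<^sup>2) * ?G)"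
      unfolding diag if_P[OF refl] conv ..
    also have "\<dots> = ?G * omega_pow (quad_form (star_op v s M) x)"
      unfolding quad_form_star_op[OF M] m_def omega_pow_add by (simp only: mult_ac)
    finally show ?thesis by (simp add: graph_vec_def)
  qed
  moreover have "clifford1 (?U i)" for i
    by (simp add: clifford1_chirp_op[OF p \<gamma>(1)] clifford1_quad_phase_op)
  ultimately show ?thesis by (intro LC_equivI)
qed

text \<open>Linear terms stay zero along the whole chain, and the label matrix property is carried
  along for use in the star steps.\<close>

lemma graph_steps_imp_LC_equiv:
  fixes M N :: "'n::finite \<Rightarrow> 'n \<Rightarrow> 'p::prime_card mod_ring"
  assumes "graph_step\<^sup>*\<^sup>* M N" and p: "odd CARD('p)" and M: "label_matrix M"
  shows "LC_equiv (graph_vec M (\<lambda>_. 0)) (graph_vec N (\<lambda>_. 0)) \<and> label_matrix N"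
  using assms(1)
proof (induction rule: rtranclp_induct)
  case base
  show ?case using M by (simp add: LC_equiv_graph_vec)
next
  case (step N N')
  then have "LC_equiv (graph_vec N (\<lambda>_. 0)) (graph_vec N' (\<lambda>_. 0))"
    using LC_equiv_circ_op LC_equiv_star_op[OF p] unfolding graph_step_def by blast
  with step show ?case
    using LC_equiv_trans label_matrix_graph_step by blast
qed

theorem theorem5:
  fixes M N :: "'n::finite \<Rightarrow> 'n \<Rightarrow> 'p::prime_card mod_ring"
    and \<psi> \<phi> :: "('n \<Rightarrow> 'p mod_ring) \<Rightarrow> complex"
  assumes "odd CARD('p)"
    and "label_matrix M" and "label_matrix N"
    and "graph_state M \<psi>" and "graph_state N \<phi>"
  shows "LC_equiv \<psi> \<phi> \<longleftrightarrow> graph_step\<^sup>*\<^sup>* M N"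
proof
  assume "LC_equiv \<psi> \<phi>"
  then show "graph_step\<^sup>*\<^sup>* M N"
    using LC_equiv_imp_local_symplectic[OF assms] local_symplectic_imp_graph_steps[OF assms(2,3)]
    by blast
next
  assume steps: "graph_step\<^sup>*\<^sup>* M N"
  obtain K l where \<psi>: "\<psi> = (\<lambda>x. K * graph_vec M l x)"
    using graph_state_eq_graph_vec[OF assms(1,2,4)] by blast
  obtain L l' where "L \<noteq> 0" and \<phi>: "\<phi> = (\<lambda>x. L * graph_vec N l' x)"
    using graph_state_eq_graph_vec[OF assms(1,3,5)] by blast
  \<comment> \<open>The linear term \<open>l\<close> is removed first, then the steps are realised,
    and finally \<open>l'\<close> is put in.\<close>
  have "LC_equiv (graph_vec M l) (graph_vec N l')"
    using graph_steps_imp_LC_equiv[OF steps assms(1,2)] LC_equiv_graph_vec LC_equiv_trans by blast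
  then show "LC_equiv \<psi> \<phi>"
    unfolding \<psi> \<phi> using \<open>L \<noteq> 0\<close> by (rule LC_equiv_scale)
qed

end
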